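(* Let $\Phi=(G,\varphi)$ be a bipartite complex unit gain graph with $n$ vertices and $m\ge1$ edges, let $V_1,V_2$ be the color classes of the underlying bipartite graph $G$, and let $\theta\in[0,2\pi]$. Consider the family of upper bounds, valid for all $\gamma\in\mathbb{R}$, $$\lambda_1(\Phi)\le\frac{m}{|V_1|}\left(\frac{(\gamma-1)^2+2\gamma\,a_\theta(\Phi)}{\gamma^2+\frac{|V_2|}{|V_1|}}\right).$$ The optimal bound for $\lambda_1(\Phi)$ in this family (optimizing over $\gamma$) is given by $$\lambda_1(\Phi)\le\begin{cases}\dfrac{m}{|V_2|} & \text{if } a_\theta(\Phi)=1,\\[2mm] \dfrac m2\left(\dfrac{n-\sqrt{n^2-4a_\theta(\Phi)(2-a_\theta(\Phi))|V_1||V_2|}}{|V_1||V_2|}\right) & \text{if } a_\theta(\Phi)\ne1.\end{cases}$$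
   Context: A complex unit gain graph ($\mathbb{T}$-gain graph) $\Phi=(G,\varphi)$ consists of a finite simple undirected graph $G$ with vertices $v_1,\dots,v_n$ and a map $\varphi$ assigning to each oriented edge $\overrightarrow{e}_{ij}$ (from $v_i$ to $v_j$, where $v_i\sim v_j$) a complex number of modulus $1$, with $\varphi(\overrightarrow{e}_{ji})=\varphi(\overrightarrow{e}_{ij})^{-1}$. Its adjacency matrix $\mathbf{A}(\Phi)=(a_{ij})$ has $a_{ij}=\varphi(\overrightarrow{e}_{ij})$ if $v_i\sim v_j$ and $a_{ij}=0$ otherwise. The gain Laplacian is $\mathbf{L}(\Phi)=\mathbf{D}(G)-\mathbf{A}(\Phi)$, where $\mathbf{D}(G)$ is the diagonal matrix of vertex degrees of $G$; it is Hermitian positive semidefinite and $\lambda_1(\Phi)$ denotes its smallest eigenvalue. For real $\theta$ define $$a_\theta(\Phi)=\frac1m\sum_{v_i\sim v_j,\ i<j}\bigl(1-\operatorname{Re}(a_{ij}e^{\mathbf{i}\theta})\bigr),$$ where $\mathbf{i}$ is the imaginary unit. "Bipartite" means that the underlying graph $G$ is bipartite, with every edge joining $V_1$ to $V_2$ and $V(G)=V_1\sqcup V_2$.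
   Formalization: The vertices are assumed numbered so that all edges go from smaller to larger index in the same direction between V_1 and V_2 (else the bounds can fail), and for a_θ=1 optimality of m/|V_2| is claimed only when |V_1| ≤ |V_2| (it fails otherwise). *)

theory Defs
  imports Complex_Main "Jordan_Normal_Form.Char_Poly"
begin

text \<open>
  The vertices \<open>v_1, \<dots>, v_n\<close> are represented by the indices \<open>0, \<dots>, n - 1\<close>, matching the
  indexing of matrices. The gain of the edge oriented from \<open>i\<close> to \<open>j\<close> is \<open>\<phi> i j\<close>; values of
  \<open>\<phi>\<close> on non-adjacent pairs are irrelevant.
\<close>

definition simple_graph :: "nat \<Rightarrow> nat set set \<Rightarrow> bool" where
  "simple_graph n E \<longleftrightarrow> (\<forall>e\<in>E. e \<subseteq> {..<n} \<and> card e = 2)"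

definition unit_gain_graph :: "nat \<Rightarrow> nat set set \<Rightarrow> (nat \<Rightarrow> nat \<Rightarrow> complex) \<Rightarrow> bool" where
  "unit_gain_graph n E \<phi> \<longleftrightarrow> simple_graph n E \<and>
     (\<forall>i j. {i, j} \<in> E \<longrightarrow> cmod (\<phi> i j) = 1 \<and> \<phi> j i = inverse (\<phi> i j))"

definition bipartition :: "nat \<Rightarrow> nat set set \<Rightarrow> nat set \<Rightarrow> nat set \<Rightarrow> bool" where
  "bipartition n E V1 V2 \<longleftrightarrow> V1 \<union> V2 = {..<n} \<and> V1 \<inter> V2 = {} \<and>
     (\<forall>e\<in>E. \<exists>u\<in>V1. \<exists>v\<in>V2. e = {u, v})"

definition vertex_degree :: "nat set set \<Rightarrow> nat \<Rightarrow> nat" where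
  "vertex_degree E i = card {j. {i, j} \<in> E}"

definition degree_matrix :: "nat \<Rightarrow> nat set set \<Rightarrow> complex mat" where
  "degree_matrix n E = mat n n (\<lambda>(i, j). if i = j then of_nat (vertex_degree E i) else 0)"

definition gain_adjacency :: "nat \<Rightarrow> nat set set \<Rightarrow> (nat \<Rightarrow> nat \<Rightarrow> complex) \<Rightarrow> complex mat" where
  "gain_adjacency n E \<phi> = mat n n (\<lambda>(i, j). if {i, j} \<in> E then \<phi> i j else 0)"

definition gain_laplacian :: "nat \<Rightarrow> nat set set \<Rightarrow> (nat \<Rightarrow> nat \<Rightarrow> complex) \<Rightarrow> complex mat" where
  "gain_laplacian n E \<phi> = degree_matrix n E - gain_adjacency n E \<phi>"

text \<open>
  The gain Laplacian is Hermitian, so for \<open>n > 0\<close> the set below is finite, nonempty and contains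
  all eigenvalues.
\<close>

definition lambda1 :: "nat \<Rightarrow> nat set set \<Rightarrow> (nat \<Rightarrow> nat \<Rightarrow> complex) \<Rightarrow> real" where
  "lambda1 n E \<phi> = Min {x. eigenvalue (gain_laplacian n E \<phi>) (complex_of_real x)}"

text \<open>Each edge is taken once, in the orientation given by the numbering of the vertices.\<close>

definition a_theta ::
  "nat \<Rightarrow> nat set set \<Rightarrow> (nat \<Rightarrow> nat \<Rightarrow> complex) \<Rightarrow> real \<Rightarrow> real" where
  "a_theta n E \<phi> \<theta> = 1 / real (card E) *
     (\<Sum>(i, j) \<in> {(i, j). i < j \<and> j < n \<and> {i, j} \<in> E}.
        1 - Re (gain_adjacency n E \<phi> $$ (i, j) * cis \<theta>))"

text \<open>
  The phase \<open>\<theta>\<close> is attached to the orientation from smaller to larger index, so for bipartite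
  graphs the vertices have to be numbered class by class; otherwise the upper bounds on
  \<open>\<lambda>_1\<close> in terms of \<open>a_\<theta>\<close> can fail (e.g. on a 4-cycle numbered cyclically). Only the
  numbering of adjacent vertices matters, and either class may come first.
\<close>

definition class_ordered :: "nat set set \<Rightarrow> nat set \<Rightarrow> nat set \<Rightarrow> bool" where
  "class_ordered E V1 V2 \<longleftrightarrow>
     (\<forall>i\<in>V1. \<forall>j\<in>V2. {i, j} \<in> E \<longrightarrow> i < j) \<or>
     (\<forall>i\<in>V1. \<forall>j\<in>V2. {i, j} \<in> E \<longrightarrow> j < i)"

end

theory Submission
  imports Defs "Jordan_Normal_Form.Spectral_Radius" "HOL-Analysis.Function_Topology"
    "HOL-Analysis.Topology_Euclidean_Space"
begin

text \<open>
  The smallest eigenvalue is at most every Rayleigh quotient of the Laplacian. The test vector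
  equal to \<open>\<gamma>\<close> on \<open>V1\<close> and \<open>1\<close> on \<open>V2\<close>, multiplied by \<open>e\<^sup>i\<^sup>\<theta>\<close> on the class containing the larger
  endpoints of the edges, produces the bound with parameter \<open>\<gamma>\<close>. Minimizing over \<open>\<gamma>\<close> amounts to
  finding the smallest eigenvalue of the pencil of the quadratic forms in the numerator and the
  denominator.
\<close>

unbundle no vec_syntax
hide_const (open) Finite_Cartesian_Product.vec

section \<open>The Rayleigh principle for Hermitian matrices\<close>

text \<open>Vectors are functions on all naturals, so that the product topology and Tychonoff
  compactness apply; entries from \<open>n\<close> on are ignored. Taking \<open>M\<close> as a
  function makes subtracting a multiple of the identity a plain pointwise operation.\<close>

definition sesq_form ::
  "nat \<Rightarrow> (nat \<Rightarrow> nat \<Rightarrow> complex) \<Rightarrow> (nat \<Rightarrow> complex) \<Rightarrow> (nat \<Rightarrow> complex) \<Rightarrow> complex" where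
  "sesq_form n M x y = (\<Sum>i<n. \<Sum>j<n. cnj (x i) * M i j * y j)"

section \<open>Algebra of sesquilinear forms\<close>

lemma sesq_form_add_left: "sesq_form n M (\<lambda>i. x i + y i) z = sesq_form n M x z + sesq_form n M y z"
  by (simp add: sesq_form_def algebra_simps sum.distrib)

lemma sesq_form_add_right: "sesq_form n M x (\<lambda>i. y i + z i) = sesq_form n M x y + sesq_form n M x z"
  by (simp add: sesq_form_def algebra_simps sum.distrib)

lemma sesq_form_scale_left: "sesq_form n M (\<lambda>i. c * x i) y = cnj c * sesq_form n M x y"
  by (simp add: sesq_form_def sum_distrib_left mult.assoc)

lemma sesq_form_scale_right: "sesq_form n M x (\<lambda>i. c * y i) = c * sesq_form n M x y"
  by (simp add: sesq_form_def sum_distrib_left algebra_simps)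

lemma sesq_form_cong:
  assumes "\<And>i. i < n \<Longrightarrow> x i = x' i" "\<And>i. i < n \<Longrightarrow> y i = y' i"
  shows "sesq_form n M x y = sesq_form n M x' y'"
  by (simp add: sesq_form_def assms)

lemma cnj_sesq_form:
  assumes "\<And>i j. i < n \<Longrightarrow> j < n \<Longrightarrow> M i j = cnj (M j i)"
  shows "cnj (sesq_form n M x y) = sesq_form n M y x"
proof -
  have "cnj (sesq_form n M x y) = (\<Sum>i<n. \<Sum>j<n. cnj (y j) * M j i * x i)"
    unfolding sesq_form_def cnj_sum
  proof (intro sum.cong refl)
    fix i j assume "i \<in> {..<n}" "j \<in> {..<n}"
    then have "M j i = cnj (M i j)" by (intro assms) auto
    then show "cnj (cnj (x i) * M i j * y j) = cnj (y j) * M j i * x i" by simp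
  qed
  also have "\<dots> = sesq_form n M y x"
    unfolding sesq_form_def by (rule sum.swap)
  finally show ?thesis .
qed

lemma sesq_form_shift:
  "sesq_form n (\<lambda>i j. M i j - (if i = j then c else 0)) x y
    = sesq_form n M x y - c * (\<Sum>i<n. cnj (x i) * y i)"
proof -
  have "sesq_form n (\<lambda>i j. M i j - (if i = j then c else 0)) x y
    = sesq_form n M x y - (\<Sum>i<n. \<Sum>j<n. if i = j then c * (cnj (x i) * y j) else 0)"
    unfolding sesq_form_def sum_subtractf[symmetric]
    by (intro sum.cong refl) (auto simp: algebra_simps)
  then show ?thesis
    by (simp add: sum_distrib_left)
qed

text \<open>Near \<open>t = 0\<close> the linear term dominates, so a nonzero \<open>b\<close> would
  make the expression negative for small \<open>t\<close> of the opposite sign.\<close>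

lemma linear_coeff_eq_0_if_quadratic_nonneg:
  fixes b c :: real
  assumes "\<And>t. 0 \<le> t * b + t\<^sup>2 * c"
  shows "b = 0"
proof (rule ccontr)
  assume "b \<noteq> 0"
  \<comment> \<open>Since \<open>D\<close> is positive and exceeds \<open>c\<close>, the point
    \<open>t = - b / D\<close> is close enough to 0 for the linear term to win.\<close>
  define D where "D = \<bar>c\<bar> + 1"
  have D: "D > 0" "c < D" by (auto simp: D_def)
  have "0 \<le> (- b / D) * b + (- b / D)\<^sup>2 * c" by (rule assms)
  also have "\<dots> = b\<^sup>2 * (c - D) / D\<^sup>2"
    using D(1) by (simp add: field_simps power2_eq_square)
  also have "\<dots> < 0"
    using D \<open>b \<noteq> 0\<close> by (intro divide_neg_pos mult_pos_neg) auto
  finally show False by simp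
qed

text \<open>The first variation of the form at \<open>x\<close> in the direction \<open>M x\<close> is \<open>2 \<parallel>M x\<parallel>\<^sup>2\<close>.\<close>

lemma psd_kernel:
  assumes herm: "\<And>i j. i < n \<Longrightarrow> j < n \<Longrightarrow> M i j = cnj (M j i)"
    and psd: "\<And>y. 0 \<le> Re (sesq_form n M y y)"
    and zero: "Re (sesq_form n M x x) = 0"
    and "i < n"
  shows "(\<Sum>j<n. M i j * x j) = 0"
proof -
  define h where "h = (\<lambda>i. \<Sum>j<n. M i j * x j)"
  define N where "N = (\<Sum>i<n. (cmod (h i))\<^sup>2)"
  have hx: "sesq_form n M h x = of_real N"
  proof -
    have "sesq_form n M h x = (\<Sum>i<n. cnj (h i) * h i)"
      by (simp add: sesq_form_def h_def sum_distrib_left mult.assoc del: cnj_sum)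
    then show ?thesis by (simp add: N_def complex_norm_square mult.commute flip: of_real_power)
  qed
  have xh: "sesq_form n M x h = of_real N"
  proof -
    have "cnj (sesq_form n M h x) = sesq_form n M x h"
      by (rule cnj_sesq_form) (rule herm)
    then show ?thesis by (simp add: hx)
  qed
  \<comment> \<open>Expansion along \<open>x + t h\<close>: the constant term vanishes by
    \<open>zero\<close>, and both cross terms equal \<open>N\<close>.\<close>
  have "0 \<le> t * (2 * N) + t\<^sup>2 * Re (sesq_form n M h h)" for t :: real
  proof -
    have "0 \<le> Re (sesq_form n M (\<lambda>i. x i + of_real t * h i) (\<lambda>i. x i + of_real t * h i))"
      by (rule psd)
    then show ?thesis
      by (simp add: sesq_form_add_left sesq_form_add_right sesq_form_scale_left
          sesq_form_scale_right hx xh zero power2_eq_square algebra_simps)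
  qed
  then have "2 * N = 0" by (rule linear_coeff_eq_0_if_quadratic_nonneg)
  then have "\<forall>i\<in>{..<n}. (cmod (h i))\<^sup>2 = 0"
    unfolding N_def by (subst sum_nonneg_eq_0_iff[symmetric]) auto
  with \<open>i < n\<close> show ?thesis by (auto simp: h_def)
qed

text \<open>With the coordinates from \<open>n\<close> on pinned to 0, the sphere is a closed subset
  of a product of closed unit discs and singletons, which is compact by Tychonoff.\<close>

lemma compact_complex_sphere:
  "compact {x :: nat \<Rightarrow> complex. (\<forall>i\<ge>n. x i = 0) \<and> (\<Sum>i<n. (cmod (x i))\<^sup>2) = 1}"
  (is "compact ?S")
proof -
  define B where "B = (\<lambda>i. if i < n then cball (0::complex) 1 else {0})"
  have "compact (PiE UNIV B)"
    using compactin_PiE[of "\<lambda>_. euclidean" UNIV B]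
    by (simp add: euclidean_product_topology B_def)
  moreover have "closed {x :: nat \<Rightarrow> complex. (\<Sum>i<n. (cmod (x i))\<^sup>2) = 1}"
    by (intro closed_Collect_eq continuous_intros continuous_on_product_coordinates)
  moreover have "?S = PiE UNIV B \<inter> {x. (\<Sum>i<n. (cmod (x i))\<^sup>2) = 1}"
  proof -
    have "cmod (x i) \<le> 1" if "i < n" "(\<Sum>i<n. (cmod (x i))\<^sup>2) = 1" for x :: "nat \<Rightarrow> complex" and i
    proof -
      have "(cmod (x i))\<^sup>2 \<le> (\<Sum>i<n. (cmod (x i))\<^sup>2)"
        using that(1) by (intro member_le_sum) auto
      then show ?thesis using that(2) by (simp add: power_le_one_iff abs_square_le_1)
    qed
    then show ?thesis
      by (auto simp: B_def PiE_iff split: if_splits)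
  qed
  ultimately show ?thesis
    by (simp add: compact_Int_closed)
qed

text \<open>Let \<open>r\<close> be the minimum of the form on the unit sphere, attained at
  \<open>x\<close> by compactness. Then \<open>A - r I\<close> is positive semidefinite and its form
  vanishes at \<open>x\<close>, so \<open>psd_kernel\<close> makes \<open>x\<close> an eigenvector
  for \<open>r\<close>.\<close>

lemma hermitian_rayleigh_min:
  fixes A :: "complex mat"
  assumes A: "A \<in> carrier_mat n n" and "n > 0"
    and herm: "\<And>i j. i < n \<Longrightarrow> j < n \<Longrightarrow> A $$ (i, j) = cnj (A $$ (j, i))"
  obtains r :: real where "eigenvalue A (of_real r)"
    and "\<And>x. r * (\<Sum>i<n. (cmod (x i))\<^sup>2) \<le> Re (sesq_form n (\<lambda>i j. A $$ (i, j)) x x)"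
proof -
  define F where "F = (\<lambda>x. Re (sesq_form n (\<lambda>i j. A $$ (i, j)) x x))"
  define S where
    "S = {x :: nat \<Rightarrow> complex. (\<forall>i\<ge>n. x i = 0) \<and> (\<Sum>i<n. (cmod (x i))\<^sup>2) = 1}"
  have "(\<lambda>i. if i = 0 then 1 else 0) \<in> S"
  proof -
    have "(\<Sum>i<n. (cmod (if i = 0 then 1 else 0))\<^sup>2) = (\<Sum>i<n. if i = 0 then 1 else 0 :: real)"
      by (intro sum.cong) auto
    then show ?thesis using \<open>n > 0\<close> by (simp add: S_def)
  qed
  moreover have "continuous_on S F"
    unfolding F_def sesq_form_def
    by (intro continuous_intros continuous_on_subset[OF continuous_on_product_coordinates]) auto
  moreover have "compact S" unfolding S_def by (rule compact_complex_sphere)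
  ultimately obtain x where "x \<in> S" and min: "\<And>y. y \<in> S \<Longrightarrow> F x \<le> F y"
    using continuous_attains_inf[of S F] by blast
  have x1: "(\<Sum>i<n. (cmod (x i))\<^sup>2) = 1" using \<open>x \<in> S\<close> by (simp add: S_def)
  define r where "r = F x"
  \<comment> \<open>The form is homogeneous of degree two, so the bound passes from the sphere to
    every vector by normalization.\<close>
  have ray: "r * (\<Sum>i<n. (cmod (y i))\<^sup>2) \<le> F y" for y
  proof (cases "(\<Sum>i<n. (cmod (y i))\<^sup>2) = 0")
    case True
    then have "y i = 0" if "i < n" for i
      using that by (subst (asm) sum_nonneg_eq_0_iff) auto
    then have "F y = 0" by (simp add: F_def sesq_form_def)
    with True show ?thesis by simp
  next
    case False
    define N where "N = (\<Sum>i<n. (cmod (y i))\<^sup>2)"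
    have "N > 0" using False unfolding N_def by (simp add: sum_nonneg less_le)
    define c where "c = complex_of_real (1 / sqrt N)"
    have c: "(cmod c)\<^sup>2 = 1 / N" and cc: "cnj c * c = of_real (1 / N)"
      using \<open>N > 0\<close> by (auto simp: c_def norm_divide power_divide real_sqrt_pow2
          simp flip: of_real_mult)
    \<comment> \<open>Membership in \<open>S\<close> demands zeros from index \<open>n\<close> on,
      hence the truncation; the form does not see it.\<close>
    define z where "z = (\<lambda>i. if i < n then c * y i else 0)"
    have "(\<Sum>i<n. (cmod (z i))\<^sup>2) = (\<Sum>i<n. (cmod c)\<^sup>2 * (cmod (y i))\<^sup>2)"
      by (intro sum.cong) (auto simp: z_def norm_mult power_mult_distrib)
    also have "\<dots> = 1"
      using \<open>N > 0\<close> by (simp add: c N_def flip: sum_divide_distrib)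
    finally have "z \<in> S" by (simp add: S_def z_def)
    then have "r \<le> F z" unfolding r_def by (rule min)
    also have "F z = Re (cnj c * c * sesq_form n (\<lambda>i j. A $$ (i, j)) y y)"
      unfolding F_def
      by (subst sesq_form_cong[where x' = "\<lambda>i. c * y i" and y' = "\<lambda>i. c * y i"])
        (auto simp: z_def sesq_form_scale_left sesq_form_scale_right mult.assoc)
    also have "\<dots> = F y / N" unfolding cc F_def by simp
    finally show ?thesis using \<open>N > 0\<close> by (simp add: N_def[symmetric] field_simps)
  qed
  define M where "M = (\<lambda>i j. A $$ (i, j) - (if i = j then of_real r else 0))"
  have Mform: "Re (sesq_form n M y y) = F y - r * (\<Sum>i<n. (cmod (y i))\<^sup>2)" for y
  proof -
    have "(\<Sum>i<n. cnj (y i) * y i) = of_real (\<Sum>i<n. (cmod (y i))\<^sup>2)"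
      by (simp add: complex_norm_square mult_ac flip: of_real_power)
    then show ?thesis
      unfolding M_def sesq_form_shift F_def by simp
  qed
  have ker: "(\<Sum>j<n. M i j * x j) = 0" if "i < n" for i
  proof (rule psd_kernel[OF _ _ _ that])
    show "M i j = cnj (M j i)" if "i < n" "j < n" for i j
      using herm[OF that] by (auto simp: M_def)
    show "0 \<le> Re (sesq_form n M y y)" for y using ray[of y] by (simp add: Mform)
    show "Re (sesq_form n M x x) = 0" by (simp add: Mform x1 r_def)
  qed
  have "eigenvector A (vec n x) (of_real r)"
  proof -
    have "vec n x \<noteq> 0\<^sub>v n"
    proof
      assume *: "vec n x = 0\<^sub>v n"
      have "x i = 0" if "i < n" for i using arg_cong[OF *, of "\<lambda>v. v $ i"] that by simp
      then show False using x1 by simp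
    qed
    moreover have "A *\<^sub>v vec n x = of_real r \<cdot>\<^sub>v vec n x"
    proof (rule eq_vecI)
      fix i assume "i < dim_vec (of_real r \<cdot>\<^sub>v vec n x)"
      then have i: "i < n" by simp
      have "(A *\<^sub>v vec n x) $ i = (\<Sum>j<n. A $$ (i, j) * x j)"
        using i A by (simp add: scalar_prod_def lessThan_atLeast0)
      also have "\<dots> = (\<Sum>j<n. M i j * x j + (if i = j then of_real r * x j else 0))"
        by (intro sum.cong) (auto simp: M_def algebra_simps)
      also have "\<dots> = of_real r * x i"
        using i ker[OF i] by (simp add: sum.distrib)
      finally show "(A *\<^sub>v vec n x) $ i = (of_real r \<cdot>\<^sub>v vec n x) $ i" using i by simp
    qed (use A in auto)
    ultimately show ?thesis using A by (auto simp: eigenvector_def)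
  qed
  then show ?thesis using that[of r] ray by (auto simp: eigenvalue_def F_def)
qed

section \<open>The gain Laplacian\<close>

lemma gain_laplacian_carrier: "gain_laplacian n E \<phi> \<in> carrier_mat n n"
  by (simp add: gain_laplacian_def degree_matrix_def gain_adjacency_def minus_carrier_mat)

lemma unit_gain_graph_cnj:
  assumes "unit_gain_graph n E \<phi>" "{i, j} \<in> E"
  shows "\<phi> j i = cnj (\<phi> i j)"
proof -
  have "cmod (\<phi> i j) = 1" "\<phi> j i = inverse (\<phi> i j)"
    using assms by (auto simp: unit_gain_graph_def)
  then show ?thesis by (metis complex_div_cnj div_by_1 inverse_eq_divide mult_1 of_real_1 power_one)
qed

lemma simple_graph_edgeD:
  assumes "simple_graph n E" "{i, j} \<in> E"
  shows "i < n" "j < n" "i \<noteq> j"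
proof -
  have "{i, j} \<subseteq> {..<n}" "card {i, j} = 2"
    using assms by (auto simp: simple_graph_def)
  then show "i < n" "j < n" "i \<noteq> j" by auto
qed

lemma gain_laplacian_index:
  assumes "simple_graph n E" "i < n" "j < n"
  shows "gain_laplacian n E \<phi> $$ (i, j) =
    (if i = j then of_nat (vertex_degree E i) else 0) - (if {i, j} \<in> E then \<phi> i j else 0)"
  using assms by (simp add: gain_laplacian_def degree_matrix_def gain_adjacency_def)

lemma lambda1_le_rayleigh:
  assumes G: "unit_gain_graph n E \<phi>" and "n > 0"
  shows "lambda1 n E \<phi> * (\<Sum>i<n. (cmod (x i))\<^sup>2)
    \<le> Re (sesq_form n (\<lambda>i j. gain_laplacian n E \<phi> $$ (i, j)) x x)"
proof -
  let ?L = "gain_laplacian n E \<phi>"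
  have S: "simple_graph n E" using G by (simp add: unit_gain_graph_def)
  have herm: "?L $$ (i, j) = cnj (?L $$ (j, i))" if "i < n" "j < n" for i j
    using unit_gain_graph_cnj[OF G, of j i] that S
    by (auto simp: gain_laplacian_index insert_commute)
  obtain r where r: "eigenvalue ?L (of_real r)"
    and ray: "\<And>x. r * (\<Sum>i<n. (cmod (x i))\<^sup>2) \<le> Re (sesq_form n (\<lambda>i j. ?L $$ (i, j)) x x)"
    using hermitian_rayleigh_min[OF gain_laplacian_carrier \<open>n > 0\<close> herm] by blast
  \<comment> \<open>\<open>Min\<close> bounds its elements from below only for a finite set. The
    real eigenvalues form the preimage of the finite spectrum under an injective map.\<close>
  have "finite (complex_of_real -` spectrum ?L)"
    using card_finite_spectrum(1)[OF gain_laplacian_carrier]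
    by (rule finite_vimageI) (simp add: inj_of_real)
  then have "finite {x. eigenvalue ?L (complex_of_real x)}"
    by (simp add: spectrum_def vimage_def)
  then have "lambda1 n E \<phi> \<le> r"
    unfolding lambda1_def using r by (intro Min_le) auto
  then have "lambda1 n E \<phi> * (\<Sum>i<n. (cmod (x i))\<^sup>2) \<le> r * (\<Sum>i<n. (cmod (x i))\<^sup>2)"
    by (intro mult_right_mono sum_nonneg) auto
  with ray[of x] show ?thesis by linarith
qed

section \<open>Sums over the edges of the graph\<close>

lemma finite_oriented_edges: "finite {(i, j). i < j \<and> j < n \<and> {i, j} \<in> (E :: nat set set)}"
  by (rule finite_subset[of _ "{..<n} \<times> {..<n}"]) auto

text \<open>Counts the summands of \<open>a_theta\<close>. Sorting the two endpoints of an edge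
  recovers its unique increasing orientation.\<close>

lemma card_oriented_edges:
  assumes "simple_graph n E"
  shows "card {(i, j). i < j \<and> j < n \<and> {i, j} \<in> E} = card E" (is "card ?P = _")
proof -
  have inj: "inj_on (\<lambda>(i, j). {i, j}) ?P"
    by (auto simp: inj_on_def doubleton_eq_iff)
  have "(\<lambda>(i, j). {i, j}) ` ?P = E"
  proof (intro equalityI subsetI)
    fix e assume e: "e \<in> E"
    then obtain i j where ij: "e = {i, j}" "i \<noteq> j"
      using assms by (auto simp: simple_graph_def card_2_iff)
    have "e = {min i j, max i j}" using ij by (auto simp: min_def max_def)
    moreover have "min i j < max i j" "max i j < n"
      using simple_graph_edgeD[OF assms, of i j] ij e by auto
    ultimately show "e \<in> (\<lambda>(i, j). {i, j}) ` ?P"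
      using e by (auto intro!: image_eqI[of _ _ "(min i j, max i j)"])
  qed auto
  then show ?thesis using card_image[OF inj] by argo
qed

text \<open>The degree of \<open>i\<close> spreads the diagonal term as one copy of
  \<open>|x i|^2\<close> over each edge at \<open>i\<close>. The two orientations of an edge have
  conjugate off-diagonal terms, which add up to twice the real part.\<close>

lemma gain_laplacian_form:
  assumes G: "unit_gain_graph n E \<phi>"
  shows "Re (sesq_form n (\<lambda>i j. gain_laplacian n E \<phi> $$ (i, j)) x x) =
    (\<Sum>(i, j) \<in> {(i, j). i < j \<and> j < n \<and> {i, j} \<in> E}.
       (cmod (x i))\<^sup>2 + (cmod (x j))\<^sup>2 - 2 * Re (cnj (x i) * \<phi> i j * x j))"
    (is "_ = sum ?f ?P")
proof -
  have S: "simple_graph n E" using G by (simp add: unit_gain_graph_def)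
  \<comment> \<open>The share of an edge that is charged to its endpoint \<open>i\<close>; the edge
    collects \<open>g (i, j) + g (j, i)\<close>.\<close>
  define g where "g = (\<lambda>(i, j). (cmod (x i))\<^sup>2 - Re (cnj (x i) * \<phi> i j * x j))"
  have row: "Re (\<Sum>j<n. cnj (x i) * gain_laplacian n E \<phi> $$ (i, j) * x j)
      = (\<Sum>j | j < n \<and> {i, j} \<in> E. g (i, j))" if i: "i < n" for i
  proof -
    \<comment> \<open>\<open>vertex_degree\<close> counts over all naturals; edges confine the
      neighbours to indices below \<open>n\<close>.\<close>
    have nb: "{j. {i, j} \<in> E} = {j. j < n \<and> {i, j} \<in> E}"
      using simple_graph_edgeD[OF S] by blast
    have "(\<Sum>j<n. cnj (x i) * gain_laplacian n E \<phi> $$ (i, j) * x j)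
      = (\<Sum>j<n. (if i = j then of_nat (vertex_degree E i) * (cnj (x i) * x i) else 0)
          - (if {i, j} \<in> E then cnj (x i) * \<phi> i j * x j else 0))"
      using i by (intro sum.cong) (auto simp: gain_laplacian_index[OF S] algebra_simps)
    also have "\<dots> = of_nat (vertex_degree E i) * (cnj (x i) * x i)
        - (\<Sum>j | j < n \<and> {i, j} \<in> E. cnj (x i) * \<phi> i j * x j)"
      using i by (simp add: sum_subtractf sum.If_cases Collect_conj_eq lessThan_def)
    also have "Re \<dots> = real (vertex_degree E i) * (cmod (x i))\<^sup>2
        - (\<Sum>j | j < n \<and> {i, j} \<in> E. Re (cnj (x i) * \<phi> i j * x j))"
      by (simp only: minus_complex.sel Re_sum)
        (simp add: cmod_power2 power2_eq_square[of "Re _"] power2_eq_square[of "Im _"])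
    also have "\<dots> = (\<Sum>j | j < n \<and> {i, j} \<in> E. g (i, j))"
      by (simp add: g_def sum_subtractf vertex_degree_def nb)
    finally show ?thesis .
  qed
  let ?Q = "{(i, j). j < i \<and> i < n \<and> {i, j} \<in> E}"
  have "Re (sesq_form n (\<lambda>i j. gain_laplacian n E \<phi> $$ (i, j)) x x)
      = (\<Sum>i<n. Re (\<Sum>j<n. cnj (x i) * gain_laplacian n E \<phi> $$ (i, j) * x j))"
    unfolding sesq_form_def by (rule Re_sum)
  also have "\<dots> = (\<Sum>i<n. \<Sum>j | j < n \<and> {i, j} \<in> E. g (i, j))"
    by (rule sum.cong) (simp_all only: row lessThan_iff)
  also have "\<dots> = sum g (SIGMA i:{..<n}. {j. j < n \<and> {i, j} \<in> E})"
    by (subst sum.Sigma) auto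
  also have "(SIGMA i:{..<n}. {j. j < n \<and> {i, j} \<in> E}) = ?P \<union> ?Q"
    using simple_graph_edgeD[OF S] by (auto; metis linorder_neqE_nat)
  also have "sum g (?P \<union> ?Q) = sum g ?P + sum g ?Q"
    by (intro sum.union_disjoint finite_oriented_edges
        finite_subset[of ?Q "{..<n} \<times> {..<n}"]) auto
  also have "sum g ?Q = sum (\<lambda>(i, j). g (j, i)) ?P"
    by (rule sum.reindex_bij_witness[of _ prod.swap prod.swap]) (auto simp: insert_commute)
  also have "sum g ?P + \<dots> = sum ?f ?P"
    unfolding sum.distrib[symmetric]
  proof (intro sum.cong refl)
    fix e assume "e \<in> ?P"
    then obtain i j where e: "e = (i, j)" "{i, j} \<in> E" by auto
    have "Re (cnj (x j) * \<phi> j i * x i) = Re (cnj (cnj (x i) * \<phi> i j * x j))"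
      by (simp only: unit_gain_graph_cnj[OF G e(2)] complex_cnj_mult complex_cnj_cnj mult_ac)
    then have "Re (cnj (x j) * \<phi> j i * x i) = Re (cnj (x i) * \<phi> i j * x j)"
      by (simp only: cnj.sel)
    then show "g e + (case e of (i, j) \<Rightarrow> g (j, i)) = ?f e"
      unfolding e g_def prod.case by linarith
  qed
  finally show ?thesis .
qed

text \<open>The family of bounds with denominators cleared: the left factor is the squared norm of
  the test vector and the right side is its Laplacian form.\<close>

lemma lambda1_bipartite:
  assumes G: "unit_gain_graph n E \<phi>" and bip: "bipartition n E V1 V2"
    and ord: "class_ordered E V1 V2" and "card E \<ge> 1"
  shows "lambda1 n E \<phi> * (real (card V1) * \<gamma>\<^sup>2 + real (card V2))
    \<le> real (card E) * ((\<gamma> - 1)\<^sup>2 + 2 * \<gamma> * a_theta n E \<phi> \<theta>)"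
proof -
  have S: "simple_graph n E" using G by (simp add: unit_gain_graph_def)
  have V: "V1 \<union> V2 = {..<n}" "V1 \<inter> V2 = {}"
    and edge: "\<And>e. e \<in> E \<Longrightarrow> \<exists>u\<in>V1. \<exists>v\<in>V2. e = {u, v}"
    using bip by (auto simp: bipartition_def)
  have fin: "finite V1" "finite V2" using V(1) by (metis finite_Un finite_lessThan)+
  have "E \<noteq> {}" using \<open>card E \<ge> 1\<close> by auto
  then have "n > 0" using edge V(1) by (cases n) auto
  define P where "P = {(i, j). i < j \<and> j < n \<and> {i, j} \<in> E}"
  \<comment> \<open>\<open>W\<close> is the class of the larger endpoints: \<open>V2\<close> or
    \<open>V1\<close>, according to which alternative of \<open>class_ordered\<close> holds.\<close>
  obtain W where W: "\<And>i j. (i, j) \<in> P \<Longrightarrow> i \<notin> W \<and> j \<in> W"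
  proof -
    have cls: "(i \<in> V1 \<and> j \<in> V2 \<or> i \<in> V2 \<and> j \<in> V1) \<and> {i, j} \<in> E \<and> i < j" if "(i, j) \<in> P" for i j
      using that edge[of "{i, j}"] by (auto simp: P_def doubleton_eq_iff)
    from ord consider "\<forall>i\<in>V1. \<forall>j\<in>V2. {i, j} \<in> E \<longrightarrow> i < j"
      | "\<forall>i\<in>V1. \<forall>j\<in>V2. {i, j} \<in> E \<longrightarrow> j < i"
      unfolding class_ordered_def by blast
    then show thesis
    proof cases
      case 1
      have "i \<notin> V2 \<and> j \<in> V2" if "(i, j) \<in> P" for i j
        using cls[OF that] 1 V(2) by (metis disjoint_iff insert_commute less_asym)
      then show thesis by (rule that)
    next
      case 2
      have "i \<notin> V1 \<and> j \<in> V1" if "(i, j) \<in> P" for i j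
        using cls[OF that] 2 V(2) by (metis disjoint_iff less_asym)
      then show thesis by (rule that)
    qed
  qed
  \<comment> \<open>On each oriented edge exactly one endpoint carries \<open>\<gamma>\<close> and
    only the larger one carries the phase, so the cross term is \<open>\<gamma>\<close> times the
    gain times \<open>cis \<theta>\<close>, whichever class comes first.\<close>
  define x where "x = (\<lambda>i. (if i \<in> V1 then of_real \<gamma> else 1) * (if i \<in> W then cis \<theta> else 1))"
  have nx: "(cmod (x i))\<^sup>2 = (if i \<in> V1 then \<gamma>\<^sup>2 else 1)" for i
    by (simp add: x_def norm_mult)
  have "(\<Sum>i<n. (cmod (x i))\<^sup>2) = (\<Sum>i\<in>V1. (cmod (x i))\<^sup>2) + (\<Sum>i\<in>V2. (cmod (x i))\<^sup>2)"
    unfolding V(1)[symmetric] using fin V(2) by (rule sum.union_disjoint)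
  also have "(\<Sum>i\<in>V1. (cmod (x i))\<^sup>2) = real (card V1) * \<gamma>\<^sup>2"
    by (simp add: nx)
  also have "(\<Sum>i\<in>V2. (cmod (x i))\<^sup>2) = (\<Sum>i\<in>V2. 1)"
    using V(2) by (intro sum.cong) (auto simp: nx)
  finally have norm: "(\<Sum>i<n. (cmod (x i))\<^sup>2) = real (card V1) * \<gamma>\<^sup>2 + real (card V2)"
    by simp
  have "Re (sesq_form n (\<lambda>i j. gain_laplacian n E \<phi> $$ (i, j)) x x) =
      (\<Sum>(i, j) \<in> P. (\<gamma> - 1)\<^sup>2 + 2 * \<gamma> * (1 - Re (gain_adjacency n E \<phi> $$ (i, j) * cis \<theta>)))"
    unfolding gain_laplacian_form[OF G] P_def[symmetric]
  proof (intro sum.cong refl, clarify)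
    fix i j assume ij: "(i, j) \<in> P"
    then have E: "{i, j} \<in> E" "i < n" "j < n" by (auto simp: P_def)
    have adj: "gain_adjacency n E \<phi> $$ (i, j) = \<phi> i j"
      using E by (simp add: gain_adjacency_def)
    have "i \<in> V1 \<longleftrightarrow> j \<notin> V1"
      using edge[OF E(1)] V(2) by (auto simp: doubleton_eq_iff)
    then have xx: "cnj (x i) * \<phi> i j * x j = of_real \<gamma> * (\<phi> i j * cis \<theta>)"
      "(cmod (x i))\<^sup>2 + (cmod (x j))\<^sup>2 = \<gamma>\<^sup>2 + 1"
      using W[OF ij] by (auto simp: nx) (auto simp: x_def)
    show "(cmod (x i))\<^sup>2 + (cmod (x j))\<^sup>2 - 2 * Re (cnj (x i) * \<phi> i j * x j) =
        (\<gamma> - 1)\<^sup>2 + 2 * \<gamma> * (1 - Re (gain_adjacency n E \<phi> $$ (i, j) * cis \<theta>))"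
      unfolding adj xx by (simp add: power2_eq_square algebra_simps)
  qed
  also have "\<dots> = real (card P) * (\<gamma> - 1)\<^sup>2
      + 2 * \<gamma> * (\<Sum>(i, j) \<in> P. 1 - Re (gain_adjacency n E \<phi> $$ (i, j) * cis \<theta>))"
    by (simp add: case_prod_unfold sum.distrib sum_distrib_left)
  also have "\<dots> = real (card E) * ((\<gamma> - 1)\<^sup>2 + 2 * \<gamma> * a_theta n E \<phi> \<theta>)"
    using \<open>card E \<ge> 1\<close> unfolding a_theta_def P_def[symmetric] card_oriented_edges[OF S, folded P_def]
    by (simp add: algebra_simps)
  finally show ?thesis
    using lambda1_le_rayleigh[OF G \<open>n > 0\<close>, of x] unfolding norm by simp
qed

section \<open>Optimizing over the parameter\<close>

text \<open>
  With \<open>b = 1 - a\<close>, the number \<open>u\<close> is the smaller root of \<open>(1 - p u) (1 - q u) = b\<^sup>2\<close>, so that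
  the numerator \<open>\<gamma>\<^sup>2 - 2 b \<gamma> + 1\<close> minus \<open>u (p \<gamma>\<^sup>2 + q)\<close> is a nonnegative multiple of a square.
\<close>

lemma optimal_gamma:
  fixes p q a :: real
  assumes p: "p > 0" and q: "q > 0" and a: "a \<noteq> 1"
  defines "u \<equiv> (p + q - sqrt ((p + q)\<^sup>2 - 4 * a * (2 - a) * p * q)) / (2 * (p * q))"
  obtains c g where "c > 0"
    and "\<And>\<gamma>. (\<gamma> - 1)\<^sup>2 + 2 * \<gamma> * a = u * (p * \<gamma>\<^sup>2 + q) + c * (\<gamma> - g)\<^sup>2"
proof -
  define s where "s = sqrt ((p + q)\<^sup>2 - 4 * a * (2 - a) * p * q)"
  \<comment> \<open>Written this way the discriminant exceeds \<open>(p - q)^2\<close> strictly,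
    because \<open>a \<noteq> 1\<close>. Hence \<open>s\<close> exceeds \<open>|p - q|\<close>,
    which yields the positivity of \<open>c\<close>.\<close>
  have disc: "(p + q)\<^sup>2 - 4 * a * (2 - a) * p * q = (p - q)\<^sup>2 + 4 * p * q * (1 - a)\<^sup>2"
    by (simp add: power2_eq_square algebra_simps)
  have pos: "4 * p * q * (1 - a)\<^sup>2 > 0" using assms by simp
  have s2: "s\<^sup>2 = (p - q)\<^sup>2 + 4 * p * q * (1 - a)\<^sup>2"
    unfolding s_def disc using pos by (intro real_sqrt_pow2) simp
  have "\<bar>p - q\<bar> < s"
    unfolding s_def disc using pos by (intro real_less_rsqrt) simp
  \<comment> \<open>The coefficient of \<open>\<gamma>^2\<close> that remains after subtracting
    \<open>u * (p * \<gamma>^2 + q)\<close>.\<close>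
  define c where "c = 1 - p * u"
  have c: "c = (q - p + s) / (2 * q)" and d: "1 - q * u = (p - q + s) / (2 * p)"
    using p q unfolding c_def u_def s_def[symmetric] by (simp_all add: field_simps)
  have "c > 0" unfolding c using \<open>\<bar>p - q\<bar> < s\<close> q by (intro divide_pos_pos) auto
  have "c * (1 - q * u) = (s\<^sup>2 - (p - q)\<^sup>2) / (4 * p * q)"
    unfolding c d by (simp add: power2_eq_square algebra_simps)
  also have "\<dots> = (1 - a)\<^sup>2" unfolding s2 using p q by simp
  finally have prod: "c * (1 - q * u) = (1 - a)\<^sup>2" .
  \<comment> \<open>Chosen to match the linear coefficient \<open>- 2 * (1 - a)\<close>; the
    constant terms then agree by the root condition \<open>prod\<close>.\<close>
  define g where "g = (1 - a) / c"
  have cg: "c * g = 1 - a" using \<open>c > 0\<close> by (simp add: g_def)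
  have "c * g\<^sup>2 = (1 - a)\<^sup>2 / c"
    using \<open>c > 0\<close> by (simp add: g_def power2_eq_square)
  then have cg2: "c * g\<^sup>2 = 1 - q * u"
    using \<open>c > 0\<close> by (simp flip: prod)
  have "(\<gamma> - 1)\<^sup>2 + 2 * \<gamma> * a = u * (p * \<gamma>\<^sup>2 + q) + c * (\<gamma> - g)\<^sup>2" for \<gamma>
  proof -
    have "c * (\<gamma> - g)\<^sup>2 = c * \<gamma>\<^sup>2 - 2 * \<gamma> * (c * g) + c * g\<^sup>2"
      by (simp add: power2_eq_square algebra_simps)
    then show ?thesis unfolding cg cg2 by (simp add: c_def power2_eq_square algebra_simps)
  qed
  with \<open>c > 0\<close> show thesis by (rule that)
qed

text \<open>Optimality means that \<open>opt\<close> is a value of the family and a lower bound for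
  all of it. For \<open>a = 1\<close> the bound is
  \<open>m * (\<gamma>^2 + 1) / (p * \<gamma>^2 + q)\<close>, monotone in \<open>\<gamma>^2\<close>
  from \<open>m / q\<close> at 0 towards \<open>m / p\<close>. So \<open>m / q\<close> is the
  minimum exactly when \<open>p \<le> q\<close>, which explains the proviso in the last
  conjunct.\<close>

theorem theorem4p7:
  fixes n :: nat and E :: "nat set set" and \<phi> :: "nat \<Rightarrow> nat \<Rightarrow> complex"
    and V1 V2 :: "nat set" and \<theta> :: real
  assumes "unit_gain_graph n E \<phi>"
    and "bipartition n E V1 V2"
    and "class_ordered E V1 V2"
    and "card E \<ge> 1"
    and "\<theta> \<in> {0..2 * pi}"
  shows "let m = real (card E); p = real (card V1); q = real (card V2);
             a = a_theta n E \<phi> \<theta>;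
             bound = (\<lambda>\<gamma>::real. m / p * (((\<gamma> - 1)\<^sup>2 + 2 * \<gamma> * a) / (\<gamma>\<^sup>2 + q / p)));
             opt = (if a = 1 then m / q
                    else m / 2 * ((real n - sqrt ((real n)\<^sup>2 - 4 * a * (2 - a) * p * q)) / (p * q)))
         in (\<forall>\<gamma>. lambda1 n E \<phi> \<le> bound \<gamma>) \<and>
            lambda1 n E \<phi> \<le> opt \<and>
            opt \<in> range bound \<and>
            ((a = 1 \<longrightarrow> card V1 \<le> card V2) \<longrightarrow> (\<forall>\<gamma>. opt \<le> bound \<gamma>))"
proof -
  define m p q a where "m = real (card E)" and "p = real (card V1)" and "q = real (card V2)"
    and "a = a_theta n E \<phi> \<theta>"
  define bound where "bound = (\<lambda>\<gamma>::real. m / p * (((\<gamma> - 1)\<^sup>2 + 2 * \<gamma> * a) / (\<gamma>\<^sup>2 + q / p)))"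
  define opt where "opt = (if a = 1 then m / q
      else m / 2 * ((real n - sqrt ((real n)\<^sup>2 - 4 * a * (2 - a) * p * q)) / (p * q)))"
  have V: "V1 \<union> V2 = {..<n}" "V1 \<inter> V2 = {}"
    and edge: "\<And>e. e \<in> E \<Longrightarrow> \<exists>u\<in>V1. \<exists>v\<in>V2. e = {u, v}"
    using assms(2) by (auto simp: bipartition_def)
  have fin: "finite V1" "finite V2" using V(1) by (metis finite_Un finite_lessThan)+
  \<comment> \<open>An edge has an endpoint in each class, so \<open>p\<close> and \<open>q\<close>
    are positive and no quotient falls back on division by zero.\<close>
  have "E \<noteq> {}" using assms(4) by auto
  then have "V1 \<noteq> {}" "V2 \<noteq> {}" using edge by blast+
  then have p: "p > 0" and q: "q > 0" using fin by (simp_all add: p_def q_def card_gt_0_iff)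
  have m: "m > 0" using assms(4) by (simp add: m_def)
  have n: "real n = p + q"
    using card_Un_disjoint[OF fin V(2)] V(1) by (simp add: p_def q_def)
  have den: "p * \<gamma>\<^sup>2 + q > 0" for \<gamma>
    using p q by (intro add_nonneg_pos) auto
  have bound: "bound \<gamma> = m * ((\<gamma> - 1)\<^sup>2 + 2 * \<gamma> * a) / (p * \<gamma>\<^sup>2 + q)" for \<gamma>
  proof -
    have "p * (\<gamma>\<^sup>2 + q / p) = p * \<gamma>\<^sup>2 + q" using p by (simp add: algebra_simps)
    then show ?thesis unfolding bound_def by (metis times_divide_times_eq)
  qed
  have le: "lambda1 n E \<phi> \<le> bound \<gamma>" for \<gamma>
    using lambda1_bipartite[OF assms(1-4), of \<gamma> \<theta>] den[of \<gamma>]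
    unfolding bound m_def p_def q_def a_def by (simp add: pos_le_divide_eq)
  have "opt \<in> range bound \<and> ((a = 1 \<longrightarrow> p \<le> q) \<longrightarrow> (\<forall>\<gamma>. opt \<le> bound \<gamma>))"
  proof (cases "a = 1")
    case True
    \<comment> \<open>For \<open>a = 1\<close> the linear term of the numerator vanishes, so the
      critical point is \<open>\<gamma> = 0\<close>.\<close>
    have "opt = bound 0" by (simp add: bound opt_def True)
    moreover have "opt \<le> bound \<gamma>" if "p \<le> q" for \<gamma>
    proof -
      have num: "(\<gamma> - 1)\<^sup>2 + 2 * \<gamma> * a = \<gamma>\<^sup>2 + 1"
        by (simp add: True power2_eq_square algebra_simps)
      have "p * \<gamma>\<^sup>2 \<le> q * \<gamma>\<^sup>2" using that by (rule mult_right_mono) simp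
      then have "m * (p * \<gamma>\<^sup>2 + q) \<le> m * ((\<gamma>\<^sup>2 + 1) * q)"
        using m by (intro mult_left_mono) (auto simp: algebra_simps)
      then show ?thesis
        unfolding bound num using True den[of \<gamma>] q
        by (simp add: opt_def frac_le_eq divide_le_eq pos_le_divide_eq mult.assoc)
    qed
    ultimately show ?thesis using True by blast
  next
    case False
    define u where "u = (p + q - sqrt ((p + q)\<^sup>2 - 4 * a * (2 - a) * p * q)) / (2 * (p * q))"
    obtain c g where "c > 0"
      and id: "\<And>\<gamma>. (\<gamma> - 1)\<^sup>2 + 2 * \<gamma> * a = u * (p * \<gamma>\<^sup>2 + q) + c * (\<gamma> - g)\<^sup>2"
      unfolding u_def using optimal_gamma[OF p q False] by blast
    have opt: "opt = m * u" using False by (simp add: opt_def u_def n)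
    \<comment> \<open>The excess over \<open>m * u\<close> is a positive multiple of
      \<open>(\<gamma> - g)^2\<close>, so the minimum is attained at
      \<open>\<gamma> = g\<close>.\<close>
    have b: "bound \<gamma> = m * u + m * c * (\<gamma> - g)\<^sup>2 / (p * \<gamma>\<^sup>2 + q)" for \<gamma>
      unfolding bound id using den[of \<gamma>] by (simp add: field_simps)
    have "opt = bound g" by (simp add: opt b)
    moreover have "opt \<le> bound \<gamma>" for \<gamma>
      unfolding opt b using m \<open>c > 0\<close> den[of \<gamma>] by simp
    ultimately show ?thesis by blast
  qed
  moreover from this have "lambda1 n E \<phi> \<le> opt" using le by auto
  moreover have "p \<le> q \<longleftrightarrow> card V1 \<le> card V2" by (simp add: p_def q_def)
  ultimately have "(\<forall>\<gamma>. lambda1 n E \<phi> \<le> bound \<gamma>) \<and> lambda1 n E \<phi> \<le> opt \<and>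
      opt \<in> range bound \<and> ((a = 1 \<longrightarrow> card V1 \<le> card V2) \<longrightarrow> (\<forall>\<gamma>. opt \<le> bound \<gamma>))"
    using le by blast
  then show ?thesis
    unfolding bound_def opt_def m_def p_def q_def a_def Let_def .
qed

end
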